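(* Let $Q$ be a PO system and $\mathscr{Y}$ a trim $Q$-partition of the primitive $\omega$-Stone space $W$. Then there is a 1--1 correspondence between (i) trim partitions of $W$ that regularly consolidate $\mathscr{Y}$, and (ii) equivalence classes of $Q$-pairs $(P,\alpha)$.
   Context: Maps are written on the right. A PO system is a set $P$ with an antisymmetric transitive relation $<$ (possibly $p<p$ for some $p$); $p\leqslant q$ means $p<q$ or $p=q$; $P^{d}=\{p\in P: p\nless p\}$; $p_{\uparrow}=\{q\in P: q\geqslant p\}$. A morphism $\alpha\colon Q\to P$ of PO systems is a map such that for each $q\in Q$, $\{r\in Q: r>q\}\alpha=\{p\in P: p>q\alpha\}$. A Stone space $W$ is a locally compact Hausdorff space with a base of compact open sets (the Stone space of a Boolean ring, possibly without $1$); $\mathrm{Co}(W)$ is the Boolean ring of its compact open subsets. $W$ is an $\omega$-Stone space if $\mathrm{Co}(W)$ is countable. For $A\in R=\mathrm{Co}(W)$ let $(A)=\{C\in R: C\subseteq A\}$; $A$ is pseudo-indecomposable (PI) if for all $B\in R$ with $B\subseteq A$, $(B)\cong(A)$ or $(A-B)\cong(A)$. $W$ is primitive if every element of $R$ is the disjoint union of finitely many PI elements. $\{X_p\mid p\in P\}^{*}$ denotes a family of pairwise disjoint non-empty subsets $X_p$ of $W$ together with the remaining set $W-X$ (possibly empty), where $X=\bigcup_p X_p$. With $S'$ the set of limit points of $S$, it is a $P$-partition if $X_p'\cap X=\bigcup_{q<p}X_q$ for all $p\in P$. For $Y\subseteq W$ its type is $T_{\mathscr{X}}(Y)=\{p: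 Y\cap X_p\neq\emptyset\}$. A compact open $A$ is $p$-trim if $T_{\mathscr{X}}(A)=p_{\uparrow}$ and, if $p\in P^d$, also $|A\cap X_p|=1$; $\mathrm{Trim}_p(\mathscr{X})$ is the set of $p$-trim sets; a set is trim if it is $p$-trim for some $p$; $\widehat{P}$ is the set of $p$ for which there is a $p$-trim set. A trim $P$-partition is a $P$-partition such that: (T1) every element of $W$ has a neighbourhood base of trim sets; (T2) for each $p\in\widehat P$, every element of $W$ with a neighbourhood base of $p$-trim sets lies in $X_p$; (T3) every point of each $X_p$ has a $p$-trim neighbourhood. (If an $\omega$-Stone space has a trim $P$-partition then $P$ is countable.) A trim partition is a trim $P$-partition for some PO system $P$; trim partitions differing only by a relabelling of the index PO system along an isomorphism are identified. For a $P$-partition $\mathscr{Z}=\{Z_p\}^*$ and a $Q$-partition $\mathscr{Y}=\{Y_q\}^*$ of $W$ satisfying T1 ($P,Q$ countable), $\mathscr{Z}$ regularly consolidates $\mathscr{Y}$ via $\alpha\colon Q\to P$ if $Y_q\subseteq Z_{q\alpha}$ for all $q\in Q$, and $p\in T_{\mathscr{Y}}(A)\alpha$ for all $p\in\widehat P$ and $A\in\mathrm{Trim}_p(\mathscr{Z})$. It regularly consolidates $\mathscr{Y}$ if it does so via some $\alpha$. A $Q$-pair is a pair $(P,\alpha)$ with $P$ a PO system and $\alpha\colon Q\to P$ a surjective morphism; $(P_1,\alpha_1)$ and $(P_2,\alpha_2)$ are equivalent if there is a PO system isomorphism $\beta\colon P_1\to P_2$ such that $q\alpha_2=q\alpha_1\beta$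 for all $q\in Q$. *)

theory Defs
  imports "HOL-Analysis.Analysis" "HOL-Algebra.QuotRing"
begin

text \<open>
  Maps are written on the left here: the image of \<open>q\<close> under \<open>\<alpha>\<close> is \<open>\<alpha> q\<close>.
\<close>

section \<open>PO systems\<close>

record 'a po_sys =
  pts :: "'a set"
  lt :: "'a rel"

definition PO_system :: "'a po_sys \<Rightarrow> bool" where
  "PO_system P \<longleftrightarrow> lt P \<subseteq> pts P \<times> pts P \<and> antisym (lt P) \<and> trans (lt P)"

definition discrete_pts :: "'a po_sys \<Rightarrow> 'a set" where
  "discrete_pts P = {p \<in> pts P. (p, p) \<notin> lt P}"

definition up_set :: "'a po_sys \<Rightarrow> 'a \<Rightarrow> 'a set" where
  "up_set P p = {q \<in> pts P. (p, q) \<in> lt P \<or> p = q}"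

definition PO_morphism :: "'q po_sys \<Rightarrow> 'p po_sys \<Rightarrow> ('q \<Rightarrow> 'p) \<Rightarrow> bool" where
  "PO_morphism Q P \<alpha> \<longleftrightarrow>
     \<alpha> \<in> pts Q \<rightarrow> pts P \<and>
     (\<forall>q\<in>pts Q. \<alpha> ` {r \<in> pts Q. (q, r) \<in> lt Q} = {p \<in> pts P. (\<alpha> q, p) \<in> lt P})"

definition PO_iso :: "'a po_sys \<Rightarrow> 'b po_sys \<Rightarrow> ('a \<Rightarrow> 'b) \<Rightarrow> bool" where
  "PO_iso P1 P2 \<beta> \<longleftrightarrow>
     bij_betw \<beta> (pts P1) (pts P2) \<and>
     (\<forall>p\<in>pts P1. \<forall>q\<in>pts P1. (p, q) \<in> lt P1 \<longleftrightarrow> (\<beta> p, \<beta> q) \<in> lt P2)"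

section \<open>Stone spaces\<close>

definition Co :: "'w topology \<Rightarrow> 'w set set" where
  "Co W = {A. compactin W A \<and> openin W A}"

definition Stone_space :: "'w topology \<Rightarrow> bool" where
  "Stone_space W \<longleftrightarrow>
     locally_compact_space W \<and> Hausdorff_space W \<and>
     (\<exists>\<B> \<subseteq> Co W. \<forall>U x. openin W U \<and> x \<in> U \<longrightarrow> (\<exists>V\<in>\<B>. x \<in> V \<and> V \<subseteq> U))"

definition omega_Stone_space :: "'w topology \<Rightarrow> bool" where
  "omega_Stone_space W \<longleftrightarrow> Stone_space W \<and> countable (Co W)"

text \<open>
  The ideal \<open>(A)\<close> of the Boolean ring \<open>Co W\<close>; as a ring in its own right it has identity \<open>A\<close>.
\<close>

definition Co_ideal :: "'w topology \<Rightarrow> 'w set \<Rightarrow> 'w set ring" where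
  "Co_ideal W A =
     \<lparr>carrier = {C \<in> Co W. C \<subseteq> A}, monoid.mult = (\<inter>), one = A,
      ring.zero = {}, add = (\<lambda>B C. (B - C) \<union> (C - B))\<rparr>"

definition pseudo_indecomposable :: "'w topology \<Rightarrow> 'w set \<Rightarrow> bool" where
  "pseudo_indecomposable W A \<longleftrightarrow>
     A \<in> Co W \<and>
     (\<forall>B\<in>Co W. B \<subseteq> A \<longrightarrow>
        Co_ideal W B \<simeq> Co_ideal W A \<or> Co_ideal W (A - B) \<simeq> Co_ideal W A)"

definition primitive_space :: "'w topology \<Rightarrow> bool" where
  "primitive_space W \<longleftrightarrow>
     (\<forall>A\<in>Co W. \<exists>\<F>. finite \<F> \<and> disjoint \<F> \<and>
        (\<forall>B\<in>\<F>. pseudo_indecomposable W B) \<and> A = \<Union>\<F>)"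

section \<open>Trim partitions\<close>

text \<open>
  A family indexed by a PO system is a total function on the index type of which only the
  values on \<open>pts P\<close> matter.  The remaining set \<open>topspace W - \<Union>(X ` pts P)\<close> of a partition
  \<open>{X p | p \<in> P}*\<close> is determined by the family and is left implicit.
\<close>

definition PO_partition :: "'w topology \<Rightarrow> 'p po_sys \<Rightarrow> ('p \<Rightarrow> 'w set) \<Rightarrow> bool" where
  "PO_partition W P X \<longleftrightarrow>
     PO_system P \<and>
     (\<forall>p\<in>pts P. X p \<noteq> {} \<and> X p \<subseteq> topspace W) \<and>
     disjoint_family_on X (pts P) \<and>
     (\<forall>p\<in>pts P. (W derived_set_of X p) \<inter> (\<Union>r\<in>pts P. X r)
                 = (\<Union>q\<in>{q \<in> pts P. (q, p) \<in> lt P}. X q))"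

definition type_of :: "'p po_sys \<Rightarrow> ('p \<Rightarrow> 'w set) \<Rightarrow> 'w set \<Rightarrow> 'p set" where
  "type_of P X A = {p \<in> pts P. A \<inter> X p \<noteq> {}}"

definition Trim :: "'w topology \<Rightarrow> 'p po_sys \<Rightarrow> ('p \<Rightarrow> 'w set) \<Rightarrow> 'p \<Rightarrow> 'w set set" where
  "Trim W P X p =
     {A \<in> Co W. type_of P X A = up_set P p \<and> (p \<in> discrete_pts P \<longrightarrow> card (A \<inter> X p) = 1)}"

definition hat :: "'w topology \<Rightarrow> 'p po_sys \<Rightarrow> ('p \<Rightarrow> 'w set) \<Rightarrow> 'p set" where
  "hat W P X = {p \<in> pts P. Trim W P X p \<noteq> {}}"

definition cond_T1 :: "'w topology \<Rightarrow> 'p po_sys \<Rightarrow> ('p \<Rightarrow> 'w set) \<Rightarrow> bool" where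
  "cond_T1 W P X \<longleftrightarrow>
     (\<forall>w\<in>topspace W. neighbourhood_base_at w (\<lambda>A. \<exists>p\<in>pts P. A \<in> Trim W P X p) W)"

definition cond_T2 :: "'w topology \<Rightarrow> 'p po_sys \<Rightarrow> ('p \<Rightarrow> 'w set) \<Rightarrow> bool" where
  "cond_T2 W P X \<longleftrightarrow>
     (\<forall>p\<in>hat W P X. \<forall>w\<in>topspace W.
        neighbourhood_base_at w (\<lambda>A. A \<in> Trim W P X p) W \<longrightarrow> w \<in> X p)"

definition cond_T3 :: "'w topology \<Rightarrow> 'p po_sys \<Rightarrow> ('p \<Rightarrow> 'w set) \<Rightarrow> bool" where
  "cond_T3 W P X \<longleftrightarrow> (\<forall>p\<in>pts P. \<forall>x\<in>X p. \<exists>A\<in>Trim W P X p. x \<in> A)"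

definition trim_partition :: "'w topology \<Rightarrow> 'p po_sys \<Rightarrow> ('p \<Rightarrow> 'w set) \<Rightarrow> bool" where
  "trim_partition W P X \<longleftrightarrow>
     PO_partition W P X \<and> cond_T1 W P X \<and> cond_T2 W P X \<and> cond_T3 W P X"

definition trim_relabelling ::
    "'w topology \<Rightarrow> (('p po_sys \<times> ('p \<Rightarrow> 'w set)) \<times> ('p po_sys \<times> ('p \<Rightarrow> 'w set))) set" where
  "trim_relabelling W =
     {((P1, X1), (P2, X2)). trim_partition W P1 X1 \<and> trim_partition W P2 X2 \<and>
        (\<exists>\<beta>. PO_iso P1 P2 \<beta> \<and> (\<forall>p\<in>pts P1. X2 (\<beta> p) = X1 p))}"

section \<open>Regular consolidation\<close>

definition regularly_consolidates_via ::
    "'w topology \<Rightarrow> 'p po_sys \<Rightarrow> ('p \<Rightarrow> 'w set) \<Rightarrow> 'q po_sys \<Rightarrow> ('q \<Rightarrow> 'w set) \<Rightarrow> ('q \<Rightarrow> 'p) \<Rightarrow> bool"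
  where
  "regularly_consolidates_via W P Z Q Y \<alpha> \<longleftrightarrow>
     PO_partition W P Z \<and> cond_T1 W P Z \<and> countable (pts P) \<and>
     PO_partition W Q Y \<and> cond_T1 W Q Y \<and> countable (pts Q) \<and>
     \<alpha> \<in> pts Q \<rightarrow> pts P \<and>
     (\<forall>q\<in>pts Q. Y q \<subseteq> Z (\<alpha> q)) \<and>
     (\<forall>p\<in>hat W P Z. \<forall>A\<in>Trim W P Z p. p \<in> \<alpha> ` type_of Q Y A)"

definition regularly_consolidates ::
    "'w topology \<Rightarrow> 'p po_sys \<Rightarrow> ('p \<Rightarrow> 'w set) \<Rightarrow> 'q po_sys \<Rightarrow> ('q \<Rightarrow> 'w set) \<Rightarrow> bool" where
  "regularly_consolidates W P Z Q Y \<longleftrightarrow> (\<exists>\<alpha>. regularly_consolidates_via W P Z Q Y \<alpha>)"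

text \<open>
  Index systems range over the PO systems carried by subsets of a type \<open>'p\<close>.  The index
  systems of trim partitions of an \<open>\<omega>\<close>-Stone space are countable, so every such partition is,
  up to relabelling, of this form as soon as \<open>'p\<close> is infinite; the same holds for \<open>Q\<close>-pairs
  with \<open>pts Q\<close> countable.
\<close>

definition consolidation_classes ::
    "'w topology \<Rightarrow> 'q po_sys \<Rightarrow> ('q \<Rightarrow> 'w set) \<Rightarrow> ('p po_sys \<times> ('p \<Rightarrow> 'w set)) set set" where
  "consolidation_classes W Q Y =
     {(P, Z). trim_partition W P Z \<and> regularly_consolidates W P Z Q Y} // trim_relabelling W"

section \<open>Q-pairs\<close>

definition Q_pair :: "'q po_sys \<Rightarrow> 'p po_sys \<Rightarrow> ('q \<Rightarrow> 'p) \<Rightarrow> bool" where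
  "Q_pair Q P \<alpha> \<longleftrightarrow> PO_system P \<and> PO_morphism Q P \<alpha> \<and> \<alpha> ` pts Q = pts P"

definition Q_pair_equiv ::
    "'q po_sys \<Rightarrow> (('p po_sys \<times> ('q \<Rightarrow> 'p)) \<times> ('p po_sys \<times> ('q \<Rightarrow> 'p))) set" where
  "Q_pair_equiv Q =
     {((P1, \<alpha>1), (P2, \<alpha>2)). Q_pair Q P1 \<alpha>1 \<and> Q_pair Q P2 \<alpha>2 \<and>
        (\<exists>\<beta>. PO_iso P1 P2 \<beta> \<and> (\<forall>q\<in>pts Q. \<alpha>2 q = \<beta> (\<alpha>1 q)))}"

definition Q_pair_classes :: "'q po_sys \<Rightarrow> ('p po_sys \<times> ('q \<Rightarrow> 'p)) set set" where
  "Q_pair_classes Q = {(P, \<alpha>). Q_pair Q P \<alpha>} // Q_pair_equiv Q"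

end

theory Submission
  imports Defs
begin

text \<open>
  A trim partition \<open>Z\<close> that regularly consolidates \<open>Y\<close> is completely recovered from its index
  map \<open>\<alpha>\<close>.  Indeed \<open>\<alpha>\<close> computes the \<open>Z\<close>-type of an open set from its \<open>Y\<close>-type
  (\<open>type_of_consolidation\<close>), and \<open>Z p\<close> consists of the points that have arbitrarily small compact
  open neighbourhoods of \<open>Z\<close>-type \<open>up_set P p\<close>.  Hence
  \<open>Z p = {w. w has a base of compact open sets A with \<alpha> ` type_of Q Y A = up_set P p}\<close>,
  and the right-hand side, called \<open>consolidate W Q Y P \<alpha> p\<close> below, mentions only \<open>Y\<close> and \<open>\<alpha>\<close>.

  This formula drives both directions.  It shows that equivalent \<open>Q\<close>-pairs come from
  relabellings of one partition.  Conversely, it defines a family from any \<open>Q\<close>-pair, and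
  that family is a trim partition which consolidates \<open>Y\<close>: the morphism property sends
  the \<open>Y\<close>-type \<open>up_set Q q\<close> of a trim set to \<open>up_set P (\<alpha> q)\<close>, so that every \<open>Y\<close>-trim set
  remains trim for the new family.  That the index map of a regular consolidation is a
  surjective morphism is where regularity enters: a relation \<open>\<alpha> q < p\<close> makes a point of \<open>Y q\<close> a
  limit of points of \<open>Z p\<close>, and small trim neighbourhoods of the latter contain points of some
  \<open>Y r\<close> with \<open>\<alpha> r = p\<close>.
\<close>

section \<open>Bijections between quotients\<close>

text \<open>
  The correspondence is given by a relation between representatives (a partition is related to
  the pairs formed with any of its index maps); it descends to the quotients because it both
  preserves and reflects equivalence.
\<close>

lemma bij_betw_quotients_if_rel_respects:
  assumes R: "equiv A R" and T: "equiv B T" and "S \<subseteq> A"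
    and dom: "\<And>x y. rel x y \<Longrightarrow> x \<in> S \<and> y \<in> B"
    and total: "\<And>x. x \<in> S \<Longrightarrow> \<exists>y. rel x y"
    and onto: "\<And>y. y \<in> B \<Longrightarrow> \<exists>x. rel x y"
    and iff: "\<And>x y x' y'. rel x y \<Longrightarrow> rel x' y' \<Longrightarrow> (x, x') \<in> R \<longleftrightarrow> (y, y') \<in> T"
  shows "\<exists>\<Phi>. bij_betw \<Phi> (S // R) (B // T) \<and> (\<forall>x y. rel x y \<longrightarrow> \<Phi> (R `` {x}) = T `` {y})"
proof -
  define \<Phi> where "\<Phi> = (\<lambda>C. \<Union> {T `` {y} | x y. rel x y \<and> R `` {x} = C})"
  have classes: "R `` {x} = R `` {x'} \<longleftrightarrow> T `` {y} = T `` {y'}" if "rel x y" "rel x' y'" for x y x' y'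
    using iff[OF that] dom[OF that(1)] dom[OF that(2)] \<open>S \<subseteq> A\<close>
    by (simp add: eq_equiv_class_iff[OF R] eq_equiv_class_iff[OF T] subset_iff)
  have \<Phi>: "\<Phi> (R `` {x}) = T `` {y}" if "rel x y" for x y
  proof -
    have "{T `` {y'} | x' y'. rel x' y' \<and> R `` {x'} = R `` {x}} = {T `` {y}}"
      using classes that by blast
    then show ?thesis
      unfolding \<Phi>_def by simp
  qed
  have "inj_on \<Phi> (S // R)"
  proof (rule inj_onI)
    fix C C'
    assume "C \<in> S // R" "C' \<in> S // R" and eq: "\<Phi> C = \<Phi> C'"
    then obtain x x' where "C = R `` {x}" "C' = R `` {x'}" "x \<in> S" "x' \<in> S"
      by (auto elim!: quotientE)
    moreover obtain y y' where "rel x y" "rel x' y'"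
      using total \<open>x \<in> S\<close> \<open>x' \<in> S\<close> by blast
    ultimately show "C = C'"
      using eq classes[of x y x' y'] \<Phi>[of x y] \<Phi>[of x' y'] by simp
  qed
  moreover have "\<Phi> ` (S // R) = B // T"
  proof
    show "\<Phi> ` (S // R) \<subseteq> B // T"
      using total dom \<Phi> by (auto elim!: quotientE) (metis quotientI)
    show "B // T \<subseteq> \<Phi> ` (S // R)"
    proof
      fix D
      assume "D \<in> B // T"
      then obtain y where y: "y \<in> B" "D = T `` {y}"
        by (auto elim!: quotientE)
      then obtain x where "rel x y"
        using onto by blast
      then show "D \<in> \<Phi> ` (S // R)"
        using \<Phi> dom y by (metis imageI quotientI)
    qed
  qed
  ultimately show ?thesis
    using \<Phi> by (auto simp: bij_betw_def)
qed

section \<open>Isomorphisms of PO systems\<close>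

lemma PO_iso_id: "PO_iso P P (\<lambda>p. p)"
  by (simp add: PO_iso_def bij_betw_def)

lemma PO_iso_inverse:
  assumes "PO_iso P1 P2 \<beta>"
  shows "PO_iso P2 P1 (inv_into (pts P1) \<beta>)"
proof -
  have \<beta>: "bij_betw \<beta> (pts P1) (pts P2)"
    using assms by (simp add: PO_iso_def)
  have inv: "bij_betw (inv_into (pts P1) \<beta>) (pts P2) (pts P1)"
    using \<beta> by (rule bij_betw_inv_into)
  have "(p, q) \<in> lt P2 \<longleftrightarrow> (inv_into (pts P1) \<beta> p, inv_into (pts P1) \<beta> q) \<in> lt P1"
    if "p \<in> pts P2" "q \<in> pts P2" for p q
    using assms bij_betwE[OF inv] bij_betw_inv_into_right[OF \<beta>] that by (simp add: PO_iso_def)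
  then show ?thesis
    using inv by (simp add: PO_iso_def)
qed

lemma PO_iso_comp:
  assumes "PO_iso P1 P2 \<beta>" "PO_iso P2 P3 \<gamma>"
  shows "PO_iso P1 P3 (\<gamma> \<circ> \<beta>)"
  using assms unfolding PO_iso_def
  by (auto intro: bij_betw_trans dest: bij_betwE)

lemma PO_iso_up_set:
  assumes "PO_iso P1 P2 \<beta>" "p \<in> pts P1"
  shows "up_set P2 (\<beta> p) = \<beta> ` up_set P1 p"
  using assms unfolding PO_iso_def up_set_def bij_betw_def inj_on_def by (auto 0 3)

lemma equiv_trim_relabelling:
  fixes W :: "'w topology"
  shows "equiv {(P :: 'p po_sys, X). trim_partition W P X} (trim_relabelling W)"
proof (rule equivI)
  show "trim_relabelling W \<subseteq> {(P :: 'p po_sys, X). trim_partition W P X} \<times> {(P :: 'p po_sys, X). trim_partition W P X}"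
    by (auto simp: trim_relabelling_def)
  show "refl_on {(P :: 'p po_sys, X). trim_partition W P X} (trim_relabelling W)"
    by (auto simp: refl_on_def trim_relabelling_def PO_iso_id intro!: exI[of _ "\<lambda>p. p"])
  show "sym (trim_relabelling W :: (('p po_sys \<times> _) \<times> _) set)"
  proof (rule symI)
    fix x y :: "'p po_sys \<times> ('p \<Rightarrow> 'w set)"
    assume xy: "(x, y) \<in> trim_relabelling W"
    obtain P1 X1 where x: "x = (P1, X1)" by (cases x)
    obtain P2 X2 where y: "y = (P2, X2)" by (cases y)
    have "\<exists>\<beta>. PO_iso P1 P2 \<beta> \<and> (\<forall>p\<in>pts P1. X2 (\<beta> p) = X1 p)"
      using xy by (simp add: trim_relabelling_def x y)
    then obtain \<beta> where \<beta>: "PO_iso P1 P2 \<beta>" and X: "\<forall>p\<in>pts P1. X2 (\<beta> p) = X1 p"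
      by blast
    have "X1 (inv_into (pts P1) \<beta> p) = X2 p" if "p \<in> pts P2" for p
      using \<beta> X that unfolding PO_iso_def
      by (metis bij_betw_imp_surj_on bij_betw_inv_into_right inv_into_into)
    moreover have "trim_partition W P1 X1" "trim_partition W P2 X2"
      using xy by (auto simp: trim_relabelling_def x y)
    ultimately show "(y, x) \<in> trim_relabelling W"
      using PO_iso_inverse[OF \<beta>]
      by (auto simp: x y trim_relabelling_def intro!: exI[of _ "inv_into (pts P1) \<beta>"])
  qed
  show "trans (trim_relabelling W :: (('p po_sys \<times> _) \<times> _) set)"
  proof (rule transI)
    fix x y z :: "'p po_sys \<times> ('p \<Rightarrow> 'w set)"
    assume xy: "(x, y) \<in> trim_relabelling W" and yz: "(y, z) \<in> trim_relabelling W"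
    obtain P1 X1 where x: "x = (P1, X1)" by (cases x)
    obtain P2 X2 where y: "y = (P2, X2)" by (cases y)
    obtain P3 X3 where z: "z = (P3, X3)" by (cases z)
    have "\<exists>\<beta>. PO_iso P1 P2 \<beta> \<and> (\<forall>p\<in>pts P1. X2 (\<beta> p) = X1 p)"
      using xy by (simp add: trim_relabelling_def x y)
    then obtain \<beta> where \<beta>: "PO_iso P1 P2 \<beta>" "\<forall>p\<in>pts P1. X2 (\<beta> p) = X1 p"
      by blast
    have "\<exists>\<gamma>. PO_iso P2 P3 \<gamma> \<and> (\<forall>p\<in>pts P2. X3 (\<gamma> p) = X2 p)"
      using yz by (simp add: trim_relabelling_def y z)
    then obtain \<gamma> where \<gamma>: "PO_iso P2 P3 \<gamma>" "\<forall>p\<in>pts P2. X3 (\<gamma> p) = X2 p"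
      by blast
    have "X3 ((\<gamma> \<circ> \<beta>) p) = X1 p" if "p \<in> pts P1" for p
    proof -
      have "\<beta> p \<in> pts P2"
        using \<beta>(1) that by (auto simp: PO_iso_def dest: bij_betwE)
      then show ?thesis
        using \<beta>(2) \<gamma>(2) that by simp
    qed
    moreover have "trim_partition W P1 X1" "trim_partition W P3 X3"
      using xy yz by (auto simp: trim_relabelling_def x z)
    ultimately show "(x, z) \<in> trim_relabelling W"
      using PO_iso_comp[OF \<beta>(1) \<gamma>(1)]
      by (auto simp: trim_relabelling_def x z intro!: exI[of _ "\<gamma> \<circ> \<beta>"])
  qed
qed

lemma equiv_Q_pair_equiv:
  fixes Q :: "'q po_sys"
  shows "equiv {(P :: 'p po_sys, \<alpha>). Q_pair Q P \<alpha>} (Q_pair_equiv Q)"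
proof (rule equivI)
  show "Q_pair_equiv Q \<subseteq> {(P :: 'p po_sys, \<alpha>). Q_pair Q P \<alpha>} \<times> {(P :: 'p po_sys, \<alpha>). Q_pair Q P \<alpha>}"
    by (auto simp: Q_pair_equiv_def)
  show "refl_on {(P :: 'p po_sys, \<alpha>). Q_pair Q P \<alpha>} (Q_pair_equiv Q)"
    by (auto simp: refl_on_def Q_pair_equiv_def PO_iso_id intro!: exI[of _ "\<lambda>p. p"])
  show "sym (Q_pair_equiv Q :: (('p po_sys \<times> _) \<times> _) set)"
  proof (rule symI)
    fix x y :: "'p po_sys \<times> ('q \<Rightarrow> 'p)"
    assume xy: "(x, y) \<in> Q_pair_equiv Q"
    obtain P1 \<alpha>1 where x: "x = (P1, \<alpha>1)" by (cases x)
    obtain P2 \<alpha>2 where y: "y = (P2, \<alpha>2)" by (cases y)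
    have "\<exists>\<beta>. PO_iso P1 P2 \<beta> \<and> (\<forall>q\<in>pts Q. \<alpha>2 q = \<beta> (\<alpha>1 q))"
      using xy by (simp add: Q_pair_equiv_def x y)
    then obtain \<beta> where \<beta>: "PO_iso P1 P2 \<beta>" and \<alpha>2: "\<forall>q\<in>pts Q. \<alpha>2 q = \<beta> (\<alpha>1 q)"
      by blast
    have pairs: "Q_pair Q P1 \<alpha>1" "Q_pair Q P2 \<alpha>2"
      using xy by (auto simp: Q_pair_equiv_def x y)
    have "inv_into (pts P1) \<beta> (\<alpha>2 q) = \<alpha>1 q" if "q \<in> pts Q" for q
      using pairs \<beta> \<alpha>2 that unfolding PO_iso_def Q_pair_def
      by (metis bij_betw_inv_into_left imageI)
    then show "(y, x) \<in> Q_pair_equiv Q"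
      using PO_iso_inverse[OF \<beta>] pairs
      by (auto simp: x y Q_pair_equiv_def intro!: exI[of _ "inv_into (pts P1) \<beta>"])
  qed
  show "trans (Q_pair_equiv Q :: (('p po_sys \<times> _) \<times> _) set)"
  proof (rule transI)
    fix x y z :: "'p po_sys \<times> ('q \<Rightarrow> 'p)"
    assume xy: "(x, y) \<in> Q_pair_equiv Q" and yz: "(y, z) \<in> Q_pair_equiv Q"
    obtain P1 \<alpha>1 where x: "x = (P1, \<alpha>1)" by (cases x)
    obtain P2 \<alpha>2 where y: "y = (P2, \<alpha>2)" by (cases y)
    obtain P3 \<alpha>3 where z: "z = (P3, \<alpha>3)" by (cases z)
    have "\<exists>\<beta>. PO_iso P1 P2 \<beta> \<and> (\<forall>q\<in>pts Q. \<alpha>2 q = \<beta> (\<alpha>1 q))"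
      using xy by (simp add: Q_pair_equiv_def x y)
    then obtain \<beta> where \<beta>: "PO_iso P1 P2 \<beta>" "\<forall>q\<in>pts Q. \<alpha>2 q = \<beta> (\<alpha>1 q)"
      by blast
    have "\<exists>\<gamma>. PO_iso P2 P3 \<gamma> \<and> (\<forall>q\<in>pts Q. \<alpha>3 q = \<gamma> (\<alpha>2 q))"
      using yz by (simp add: Q_pair_equiv_def y z)
    then obtain \<gamma> where \<gamma>: "PO_iso P2 P3 \<gamma>" "\<forall>q\<in>pts Q. \<alpha>3 q = \<gamma> (\<alpha>2 q)"
      by blast
    have "\<alpha>3 q = (\<gamma> \<circ> \<beta>) (\<alpha>1 q)" if "q \<in> pts Q" for q
      using \<beta>(2) \<gamma>(2) that by simp
    moreover have "Q_pair Q P1 \<alpha>1" "Q_pair Q P3 \<alpha>3"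
      using xy yz by (auto simp: Q_pair_equiv_def x z)
    ultimately show "(x, z) \<in> Q_pair_equiv Q"
      using PO_iso_comp[OF \<beta>(1) \<gamma>(1)]
      by (auto simp: Q_pair_equiv_def x z intro!: exI[of _ "\<gamma> \<circ> \<beta>"])
  qed
qed

section \<open>Trim partitions\<close>

lemma up_set_refl: "p \<in> pts P \<Longrightarrow> p \<in> up_set P p"
  by (simp add: up_set_def)

lemma up_set_antisym:
  assumes "PO_system P" "p \<in> up_set P q" "q \<in> up_set P p"
  shows "p = q"
  using assms by (auto simp: PO_system_def up_set_def antisym_def)

lemma type_of_mono: "A \<subseteq> B \<Longrightarrow> type_of P X A \<subseteq> type_of P X B"
  by (auto simp: type_of_def)

lemma Trim_D:
  assumes "A \<in> Trim W P X p"
  shows "A \<in> Co W" "openin W A" "type_of P X A = up_set P p"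
  using assms by (auto simp: Trim_def Co_def)

lemma T1_trim_nbhd:
  assumes "cond_T1 W P X" "openin W U" "w \<in> U"
  obtains p A where "p \<in> pts P" "A \<in> Trim W P X p" "w \<in> A" "A \<subseteq> U"
proof -
  have "w \<in> topspace W"
    using assms(2,3) openin_subset by blast
  then have "neighbourhood_base_at w (\<lambda>A. \<exists>p\<in>pts P. A \<in> Trim W P X p) W"
    using assms(1) by (auto simp: cond_T1_def)
  with assms(2,3) show ?thesis
    using that unfolding neighbourhood_base_at_def by blast
qed

text \<open>
  A trim set squeezed between two neighbourhoods of type \<open>up_set P p\<close> can only be
  \<open>p\<close>-trim, by antisymmetry.
\<close>

lemma trim_nbhd_of_member:
  assumes X: "trim_partition W P X" and p: "p \<in> pts P" and w: "w \<in> X p"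
    and U: "openin W U" "w \<in> U"
  obtains A where "A \<in> Trim W P X p" "w \<in> A" "A \<subseteq> U"
proof -
  obtain C where C: "C \<in> Trim W P X p" "w \<in> C"
    using X p w by (auto simp: trim_partition_def cond_T3_def)
  have "openin W (C \<inter> U)" "w \<in> C \<inter> U"
    using C(2) U Trim_D(2)[OF C(1)] by auto
  then obtain s A where A: "s \<in> pts P" "A \<in> Trim W P X s" "w \<in> A" "A \<subseteq> C \<inter> U"
    using T1_trim_nbhd X unfolding trim_partition_def by metis
  have "p \<in> type_of P X A"
    using A w p by (auto simp: type_of_def)
  moreover have "s \<in> type_of P X C"
    using A(4) type_of_mono[of A C P X] Trim_D(3)[OF A(2)] up_set_refl[OF A(1)] by auto
  ultimately have "p = s"
    using Trim_D(3)[OF A(2)] Trim_D(3)[OF C(1)] X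
    by (intro up_set_antisym) (auto simp: trim_partition_def PO_partition_def)
  then show ?thesis
    using that A by blast
qed

text \<open>Distinct indices have distinct trim sets, so there are at most as many as compact open sets.\<close>

lemma countable_index_of_trim_partition:
  assumes W: "countable (Co W)" and X: "trim_partition W P X"
  shows "countable (pts P)"
proof -
  have PO: "PO_system P"
    using X by (simp add: trim_partition_def PO_partition_def)
  have "\<exists>A. A \<in> Trim W P X p" if "p \<in> pts P" for p
    using X that unfolding trim_partition_def PO_partition_def cond_T3_def by fast
  then obtain A where A: "A p \<in> Trim W P X p" if "p \<in> pts P" for p
    by metis
  have "inj_on A (pts P)"
  proof (rule inj_onI)
    fix p q
    assume pq: "p \<in> pts P" "q \<in> pts P" "A p = A q"
    then have "up_set P p = up_set P q"
      using Trim_D(3)[OF A] by metis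
    then show "p = q"
      using up_set_antisym[OF PO] up_set_refl pq by metis
  qed
  moreover have "countable (A ` pts P)"
    using countable_subset[OF image_subsetI W] Trim_D(1)[OF A] by blast
  ultimately show ?thesis
    using countable_image_inj_eq by blast
qed

lemma member_index_unique:
  assumes "PO_partition W P X" "p \<in> pts P" "r \<in> pts P" "w \<in> X p" "w \<in> X r"
  shows "p = r"
  using assms unfolding PO_partition_def disjoint_family_on_def by blast

lemma less_imp_limit_point:
  assumes "PO_partition W P X" "(q, p) \<in> lt P" "w \<in> X q" "openin W U" "w \<in> U"
  obtains z where "z \<in> U" "z \<in> X p" "z \<noteq> w"
proof -
  have "q \<in> pts P" "p \<in> pts P"
    using assms(1,2) by (auto simp: PO_partition_def PO_system_def)
  then have "w \<in> W derived_set_of X p"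
    using assms(1,2,3) unfolding PO_partition_def by blast
  then show ?thesis
    using assms(4,5) that unfolding derived_set_of_def by blast
qed

lemma limit_point_imp_less:
  assumes "PO_partition W P X" "p \<in> pts P" "q \<in> pts P" "w \<in> X q" "w \<in> W derived_set_of X p"
  shows "(q, p) \<in> lt P"
proof -
  obtain r where "r \<in> pts P" "(r, p) \<in> lt P" "w \<in> X r"
    using assms unfolding PO_partition_def by blast
  then show ?thesis
    using member_index_unique[OF assms(1) _ assms(3) _ assms(4)] by blast
qed

lemma trim_point_unique:
  assumes "A \<in> Trim W P X p" "p \<in> discrete_pts P" "x \<in> A" "x \<in> X p" "y \<in> A" "y \<in> X p"
  shows "x = y"
proof -
  obtain z where "A \<inter> X p = {z}"
    using assms(1,2) by (auto simp: Trim_def card_1_singleton_iff)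
  then show ?thesis
    using assms(3-6) by (metis IntI singletonD)
qed

section \<open>The index map of a regular consolidation\<close>

lemma PO_morphism_up_set:
  assumes "PO_morphism Q P \<alpha>" "q \<in> pts Q"
  shows "\<alpha> ` up_set Q q = up_set P (\<alpha> q)"
proof -
  have "up_set Q q = insert q {r \<in> pts Q. (q, r) \<in> lt Q}"
    using assms(2) by (auto simp: up_set_def)
  moreover have "up_set P (\<alpha> q) = insert (\<alpha> q) {p \<in> pts P. (\<alpha> q, p) \<in> lt P}"
    using assms by (auto simp: up_set_def PO_morphism_def)
  ultimately show ?thesis
    using assms by (simp add: PO_morphism_def)
qed

text \<open>
  A point of \<open>A \<inter> Z p\<close> has a \<open>p\<close>-trim neighbourhood inside \<open>A\<close>; regularity provides a \<open>Y q\<close>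
  with \<open>\<alpha> q = p\<close> that meets it.
\<close>

lemma type_of_consolidation:
  assumes Z: "trim_partition W P Z" and via: "regularly_consolidates_via W P Z Q Y \<alpha>"
    and A: "openin W A"
  shows "type_of P Z A = \<alpha> ` type_of Q Y A"
proof
  show "\<alpha> ` type_of Q Y A \<subseteq> type_of P Z A"
    using via unfolding regularly_consolidates_via_def type_of_def by fastforce
  show "type_of P Z A \<subseteq> \<alpha> ` type_of Q Y A"
  proof
    fix p
    assume "p \<in> type_of P Z A"
    then obtain z where z: "p \<in> pts P" "z \<in> Z p" "z \<in> A"
      by (auto simp: type_of_def)
    then obtain B where B: "B \<in> Trim W P Z p" "B \<subseteq> A"
      using trim_nbhd_of_member[OF Z] A by metis
    then have "p \<in> \<alpha> ` type_of Q Y B"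
      using via z(1) unfolding regularly_consolidates_via_def hat_def by blast
    then show "p \<in> \<alpha> ` type_of Q Y A"
      using type_of_mono[OF B(2), of Q Y] by blast
  qed
qed

lemma consolidation_Q_pair:
  assumes W: "Hausdorff_space W" and Y: "trim_partition W Q Y" and Z: "trim_partition W P Z"
    and via: "regularly_consolidates_via W P Z Q Y \<alpha>"
  shows "Q_pair Q P \<alpha>"
proof -
  have YP: "PO_partition W Q Y" and ZP: "PO_partition W P Z"
    using Y Z by (auto simp: trim_partition_def)
  have POP: "PO_system P"
    using ZP by (simp add: PO_partition_def)
  have \<alpha>: "\<alpha> q \<in> pts P" "Y q \<subseteq> Z (\<alpha> q)" if "q \<in> pts Q" for q
    using via that by (auto simp: regularly_consolidates_via_def)
  have "pts P \<subseteq> \<alpha> ` pts Q"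
  proof
    fix p
    assume p: "p \<in> pts P"
    have "p \<in> type_of P Z (topspace W)"
      using ZP p unfolding PO_partition_def type_of_def by blast
    then show "p \<in> \<alpha> ` pts Q"
      using type_of_consolidation[OF Z via openin_topspace] by (auto simp: type_of_def)
  qed
  moreover have "\<alpha> ` {r \<in> pts Q. (q, r) \<in> lt Q} = {p \<in> pts P. (\<alpha> q, p) \<in> lt P}"
    if q: "q \<in> pts Q" for q
  proof
    have "Y q \<noteq> {}"
      using YP q by (simp add: PO_partition_def)
    then obtain y where y: "y \<in> Y q"
      by blast
    have ytop: "y \<in> topspace W"
      using YP q y by (auto simp: PO_partition_def)
    show "\<alpha> ` {r \<in> pts Q. (q, r) \<in> lt Q} \<subseteq> {p \<in> pts P. (\<alpha> q, p) \<in> lt P}"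
    proof clarify
      fix r
      assume r: "r \<in> pts Q" "(q, r) \<in> lt Q"
      have "y \<in> W derived_set_of Y r"
        using less_imp_limit_point[OF YP r(2) y] ytop unfolding derived_set_of_def by blast
      then have "y \<in> W derived_set_of Z (\<alpha> r)"
        using derived_set_of_mono \<alpha>(2)[OF r(1)] by blast
      then show "\<alpha> r \<in> pts P \<and> (\<alpha> q, \<alpha> r) \<in> lt P"
        using limit_point_imp_less[OF ZP] \<alpha> q r(1) y by blast
    qed
    show "{p \<in> pts P. (\<alpha> q, p) \<in> lt P} \<subseteq> \<alpha> ` {r \<in> pts Q. (q, r) \<in> lt Q}"
    proof clarify
      fix p
      assume p: "p \<in> pts P" "(\<alpha> q, p) \<in> lt P"
      obtain A where A: "A \<in> Trim W Q Y q" "y \<in> A"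
        using trim_nbhd_of_member[OF Y q y] ytop by blast
      obtain z where z: "z \<in> A" "z \<in> Z p" "z \<noteq> y"
        using less_imp_limit_point[OF ZP p(2)] \<alpha>(2)[OF q] y A Trim_D(2)[OF A(1)] by blast
      have "openin W (A - {y})"
        using W Trim_D(2)[OF A(1)] ytop
        by (metis Hausdorff_imp_t1_space t1_space_openin_delete_alt)
      moreover have "p \<in> type_of P Z (A - {y})"
        using z p(1) by (auto simp: type_of_def)
      ultimately obtain r where r: "r \<in> type_of Q Y (A - {y})" "p = \<alpha> r"
        using type_of_consolidation[OF Z via] by blast
      then have "r \<in> up_set Q q"
        using type_of_mono[of "A - {y}" A Q Y] Trim_D(3)[OF A(1)] by blast
      moreover have "(q, q) \<in> lt Q" if "r = q"
      proof (rule ccontr)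
        \<comment> \<open>Here \<open>A\<close> meets \<open>Y q\<close> only in \<open>y\<close>, which was removed.\<close>
        assume "(q, q) \<notin> lt Q"
        then have "q \<in> discrete_pts Q"
          using q by (simp add: discrete_pts_def)
        moreover obtain x where "x \<in> A" "x \<noteq> y" "x \<in> Y q"
          using r(1) \<open>r = q\<close> by (auto simp: type_of_def)
        ultimately show False
          using trim_point_unique[OF A(1)] A(2) y by blast
      qed
      ultimately show "p \<in> \<alpha> ` {r \<in> pts Q. (q, r) \<in> lt Q}"
        using r(2) by (auto simp: up_set_def)
    qed
  qed
  ultimately show ?thesis
    using POP \<alpha>(1) by (auto simp: Q_pair_def PO_morphism_def)
qed

section \<open>The partition determined by an index map\<close>

text \<open>
  The points with a neighbourhood base of compact open sets whose \<open>Y\<close>-type is mapped onto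
  \<open>up_set P p\<close>.  Types alone suffice here, also for discrete \<open>p\<close>: a trim set squeezed between
  two members of such a base is \<open>p\<close>-trim, and so contains just one point of the part \<open>p\<close>.
\<close>

definition consolidate ::
    "'w topology \<Rightarrow> 'q po_sys \<Rightarrow> ('q \<Rightarrow> 'w set) \<Rightarrow> 'p po_sys \<Rightarrow> ('q \<Rightarrow> 'p) \<Rightarrow> 'p \<Rightarrow> 'w set" where
  "consolidate W Q Y P \<alpha> p = {w \<in> topspace W. \<forall>U. openin W U \<and> w \<in> U \<longrightarrow>
     (\<exists>A\<in>Co W. w \<in> A \<and> A \<subseteq> U \<and> \<alpha> ` type_of Q Y A = up_set P p)}"

lemma consolidateD:
  assumes "w \<in> consolidate W Q Y P \<alpha> p" "openin W U" "w \<in> U"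
  obtains A where "A \<in> Co W" "openin W A" "w \<in> A" "A \<subseteq> U" "\<alpha> ` type_of Q Y A = up_set P p"
  using assms that unfolding consolidate_def Co_def by blast

theorem consolidation_determined_by_index_map:
  assumes Z: "trim_partition W P Z" and via: "regularly_consolidates_via W P Z Q Y \<alpha>"
    and p: "p \<in> pts P"
  shows "Z p = consolidate W Q Y P \<alpha> p"
proof
  have ZP: "PO_partition W P Z" and T1: "cond_T1 W P Z" and T2: "cond_T2 W P Z"
    and PO: "PO_system P"
    using Z by (auto simp: trim_partition_def PO_partition_def)
  show "Z p \<subseteq> consolidate W Q Y P \<alpha> p"
  proof
    fix w
    assume w: "w \<in> Z p"
    have "\<exists>A\<in>Co W. w \<in> A \<and> A \<subseteq> U \<and> \<alpha> ` type_of Q Y A = up_set P p"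
      if U: "openin W U" "w \<in> U" for U
    proof -
      obtain A where "A \<in> Trim W P Z p" "w \<in> A" "A \<subseteq> U"
        using trim_nbhd_of_member[OF Z p w U] .
      then show ?thesis
        using Trim_D[of A W P Z p] type_of_consolidation[OF Z via, of A] by metis
    qed
    moreover have "w \<in> topspace W"
      using ZP p w by (auto simp: PO_partition_def)
    ultimately show "w \<in> consolidate W Q Y P \<alpha> p"
      by (auto simp: consolidate_def)
  qed
  show "consolidate W Q Y P \<alpha> p \<subseteq> Z p"
  proof
    fix w
    assume w: "w \<in> consolidate W Q Y P \<alpha> p"
    have base: "\<exists>B\<in>Trim W P Z p. w \<in> B \<and> B \<subseteq> U" if U: "openin W U" "w \<in> U" for U
    proof -
      obtain A where A: "openin W A" "w \<in> A" "A \<subseteq> U" "type_of P Z A = up_set P p"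
        using consolidateD[OF w U] type_of_consolidation[OF Z via] by metis
      obtain s B where B: "s \<in> pts P" "B \<in> Trim W P Z s" "w \<in> B" "B \<subseteq> A"
        using T1_trim_nbhd[OF T1 A(1,2)] .
      obtain A' where A': "A' \<subseteq> B" "type_of P Z A' = up_set P p"
        using consolidateD[OF w Trim_D(2)[OF B(2)] B(3)] type_of_consolidation[OF Z via] by metis
      have "s \<in> up_set P p"
        using type_of_mono[OF B(4), of P Z] up_set_refl[OF B(1)] Trim_D(3)[OF B(2)] A(4) by blast
      moreover have "p \<in> up_set P s"
        using type_of_mono[OF A'(1), of P Z] up_set_refl[OF p] Trim_D(3)[OF B(2)] A'(2) by blast
      ultimately have "s = p"
        using up_set_antisym[OF PO] by blast
      then show ?thesis
        using B A(3) by blast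
    qed
    have top: "w \<in> topspace W"
      using w by (simp add: consolidate_def)
    have "neighbourhood_base_at w (\<lambda>A. A \<in> Trim W P Z p) W"
      unfolding neighbourhood_base_at_def using base Trim_D(2) by metis
    moreover have "p \<in> hat W P Z"
      using base[OF openin_topspace top] p by (auto simp: hat_def)
    ultimately show "w \<in> Z p"
      using T2 top by (auto simp: cond_T2_def)
  qed
qed

text \<open>
  Conversely, \<open>consolidate\<close> turns an arbitrary surjective morphism \<open>\<alpha>\<close> into a trim partition;
  the locale fixes such an \<open>\<alpha>\<close> while the defining conditions are verified one after the other.
\<close>

locale pair_over_trim_partition =
  fixes W :: "'w topology" and Q :: "'q po_sys" and Y :: "'q \<Rightarrow> 'w set"
    and P :: "'p po_sys" and \<alpha> :: "'q \<Rightarrow> 'p"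
  assumes Hausdorff: "Hausdorff_space W" and countable_Co: "countable (Co W)"
    and trim_Y: "trim_partition W Q Y" and pair: "Q_pair Q P \<alpha>"
begin

abbreviation Z :: "'p \<Rightarrow> 'w set" where
  "Z \<equiv> consolidate W Q Y P \<alpha>"

lemma PO_P: "PO_system P" and mor: "PO_morphism Q P \<alpha>" and surj: "\<alpha> ` pts Q = pts P"
  and \<alpha>_in: "q \<in> pts Q \<Longrightarrow> \<alpha> q \<in> pts P"
  using pair by (auto simp: Q_pair_def)

lemma part_Y: "PO_partition W Q Y" and T1_Y: "cond_T1 W Q Y"
  using trim_Y by (auto simp: trim_partition_def)

lemma strict_mono: "(q, r) \<in> lt Q \<Longrightarrow> (\<alpha> q, \<alpha> r) \<in> lt P"
  using part_Y mor unfolding PO_morphism_def PO_partition_def PO_system_def by blast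

lemma lift_less:
  assumes "q \<in> pts Q" "(\<alpha> q, p) \<in> lt P"
  obtains r where "r \<in> pts Q" "(q, r) \<in> lt Q" "\<alpha> r = p"
proof -
  have "p \<in> {p \<in> pts P. (\<alpha> q, p) \<in> lt P}"
    using assms PO_P by (auto simp: PO_system_def)
  also have "\<dots> = \<alpha> ` {r \<in> pts Q. (q, r) \<in> lt Q}"
    using mor assms(1) by (simp add: PO_morphism_def)
  finally show ?thesis
    using that by blast
qed

lemma Y_subset:
  assumes q: "q \<in> pts Q"
  shows "Y q \<subseteq> Z (\<alpha> q)"
proof
  fix w
  assume w: "w \<in> Y q"
  have "\<exists>A\<in>Co W. w \<in> A \<and> A \<subseteq> U \<and> \<alpha> ` type_of Q Y A = up_set P (\<alpha> q)"
    if U: "openin W U" "w \<in> U" for U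
  proof -
    obtain A where "A \<in> Trim W Q Y q" "w \<in> A" "A \<subseteq> U"
      using trim_nbhd_of_member[OF trim_Y q w U] .
    then show ?thesis
      using PO_morphism_up_set[OF mor q] Trim_D by metis
  qed
  moreover have "w \<in> topspace W"
    using part_Y q w by (auto simp: PO_partition_def)
  ultimately show "w \<in> Z (\<alpha> q)"
    by (auto simp: consolidate_def)
qed

lemma type_of_Z:
  assumes "openin W A"
  shows "type_of P Z A = \<alpha> ` type_of Q Y A"
proof
  show "\<alpha> ` type_of Q Y A \<subseteq> type_of P Z A"
    using Y_subset \<alpha>_in by (fastforce simp: type_of_def)
  show "type_of P Z A \<subseteq> \<alpha> ` type_of Q Y A"
  proof
    fix p
    assume "p \<in> type_of P Z A"
    then obtain w where w: "p \<in> pts P" "w \<in> Z p" "w \<in> A"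
      by (auto simp: type_of_def)
    then obtain B where "B \<subseteq> A" "\<alpha> ` type_of Q Y B = up_set P p"
      using consolidateD assms by metis
    then show "p \<in> \<alpha> ` type_of Q Y A"
      using type_of_mono[of B A Q Y] up_set_refl[OF w(1)] by blast
  qed
qed

text \<open>
  The cardinality condition is inherited because \<open>Y q\<close> is dense enough in \<open>Z (\<alpha> q)\<close>: inside a
  \<open>q\<close>-trim set, a point of \<open>Z (\<alpha> q)\<close> with \<open>\<alpha> q\<close> discrete is approximated by points of \<open>Y q\<close>,
  of which there is only one.
\<close>

lemma Trim_Y_imp_Trim_Z:
  assumes q: "q \<in> pts Q" and A: "A \<in> Trim W Q Y q"
  shows "A \<in> Trim W P Z (\<alpha> q)"
proof -
  have "card (A \<inter> Z (\<alpha> q)) = 1" if disc: "\<alpha> q \<in> discrete_pts P"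
  proof -
    have irrefl: "(\<alpha> q, \<alpha> q) \<notin> lt P"
      using disc by (simp add: discrete_pts_def)
    then have "q \<in> discrete_pts Q"
      using q strict_mono by (auto simp: discrete_pts_def)
    then obtain y where y: "A \<inter> Y q = {y}"
      using A by (auto simp: Trim_def card_1_singleton_iff)
    have "z = y" if z: "z \<in> A" "z \<in> Z (\<alpha> q)" for z
    proof (rule ccontr)
      assume "z \<noteq> y"
      have "openin W (A - {y})"
        using Hausdorff Trim_D(2)[OF A]
        by (metis Diff_empty Diff_insert0 Hausdorff_imp_t1_space t1_space_openin_delete_alt)
      moreover have "\<alpha> q \<in> type_of P Z (A - {y})"
        using z \<open>z \<noteq> y\<close> \<alpha>_in[OF q] by (auto simp: type_of_def)
      ultimately obtain r where r: "r \<in> type_of Q Y (A - {y})" "\<alpha> r = \<alpha> q"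
        using type_of_Z by force
      then have "r \<in> up_set Q q"
        using type_of_mono[of "A - {y}" A Q Y] Trim_D(3)[OF A] by blast
      then have "r = q"
        using strict_mono[of q r] r(2) irrefl by (auto simp: up_set_def)
      then show False
        using r(1) y by (auto simp: type_of_def)
    qed
    moreover have "y \<in> A \<inter> Z (\<alpha> q)"
      using y Y_subset[OF q] by blast
    ultimately have "A \<inter> Z (\<alpha> q) = {y}"
      by blast
    then show ?thesis
      by simp
  qed
  then show ?thesis
    using Trim_D[OF A] type_of_Z[of A] PO_morphism_up_set[OF mor q] by (auto simp: Trim_def)
qed

text \<open>
  The same squeezing as for members of a trim partition, now with a \<open>Y\<close>-trim set in the middle.
\<close>

lemma Y_trim_nbhd_of_Z_member:
  assumes p: "p \<in> pts P" and w: "w \<in> Z p" and U: "openin W U" "w \<in> U"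
  obtains q A where "q \<in> pts Q" "\<alpha> q = p" "A \<in> Trim W Q Y q" "w \<in> A" "A \<subseteq> U"
proof -
  obtain A where A: "openin W A" "w \<in> A" "A \<subseteq> U" "\<alpha> ` type_of Q Y A = up_set P p"
    using consolidateD[OF w U] .
  obtain q B where B: "q \<in> pts Q" "B \<in> Trim W Q Y q" "w \<in> B" "B \<subseteq> A"
    using T1_trim_nbhd[OF T1_Y A(1,2)] .
  obtain A' where A': "A' \<subseteq> B" "\<alpha> ` type_of Q Y A' = up_set P p"
    using consolidateD[OF w Trim_D(2)[OF B(2)] B(3)] .
  have typB: "\<alpha> ` type_of Q Y B = up_set P (\<alpha> q)"
    using Trim_D(3)[OF B(2)] PO_morphism_up_set[OF mor B(1)] by simp
  have "\<alpha> q \<in> up_set P p"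
    using type_of_mono[OF B(4), of Q Y] up_set_refl[OF \<alpha>_in[OF B(1)]] typB A(4) by blast
  moreover have "p \<in> up_set P (\<alpha> q)"
    using type_of_mono[OF A'(1), of Q Y] up_set_refl[OF p] typB A'(2) by blast
  ultimately have "\<alpha> q = p"
    using up_set_antisym[OF PO_P] by blast
  then show ?thesis
    using that B A(3) by blast
qed

lemma Z_disjoint:
  assumes "p \<in> pts P" "r \<in> pts P" "w \<in> Z p" "w \<in> Z r"
  shows "p = r"
proof -
  have "w \<in> topspace W"
    using assms(3) by (simp add: consolidate_def)
  \<comment> \<open>Alternate the two bases: the type of the middle set bounds one index from each side.\<close>
  obtain A where A: "openin W A" "w \<in> A" "\<alpha> ` type_of Q Y A = up_set P p"
    using consolidateD[OF assms(3) openin_topspace \<open>w \<in> topspace W\<close>] by metis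
  obtain B where B: "openin W B" "w \<in> B" "B \<subseteq> A" "\<alpha> ` type_of Q Y B = up_set P r"
    using consolidateD[OF assms(4) A(1,2)] by metis
  obtain C where C: "C \<subseteq> B" "\<alpha> ` type_of Q Y C = up_set P p"
    using consolidateD[OF assms(3) B(1,2)] by metis
  have "r \<in> up_set P p" "p \<in> up_set P r"
    using type_of_mono[OF B(3), of Q Y] type_of_mono[OF C(1), of Q Y] A(3) B(4) C(2)
      up_set_refl[OF assms(1)] up_set_refl[OF assms(2)] by blast+
  then show ?thesis
    using up_set_antisym[OF PO_P] by blast
qed

lemma Z_limit_imp_less:
  assumes p: "p \<in> pts P" and r: "r \<in> pts P" and w: "w \<in> Z r" "w \<in> W derived_set_of Z p"
  shows "(r, p) \<in> lt P"
proof -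
  have "w \<in> topspace W"
    using w(1) by (simp add: consolidate_def)
  then obtain q A where A: "q \<in> pts Q" "\<alpha> q = r" "A \<in> Trim W Q Y q" "w \<in> A"
    using Y_trim_nbhd_of_Z_member[OF r w(1) openin_topspace] by metis
  have AZ: "A \<in> Trim W P Z r"
    using Trim_Y_imp_Trim_Z A by blast
  obtain z where z: "z \<noteq> w" "z \<in> Z p" "z \<in> A"
    using w(2) A(4) Trim_D(2)[OF A(3)] unfolding derived_set_of_def by blast
  then have "p \<in> up_set P r"
    using Trim_D(3)[OF AZ] p by (auto simp: type_of_def)
  moreover have "(r, r) \<in> lt P" if "p = r"
    using trim_point_unique[OF AZ _ z(3) _ A(4) w(1)] z that r by (auto simp: discrete_pts_def)
  ultimately show ?thesis
    by (auto simp: up_set_def)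
qed

lemma less_imp_Z_limit:
  assumes less: "(r, p) \<in> lt P" and w: "w \<in> Z r"
  shows "w \<in> W derived_set_of Z p"
proof -
  have rp: "r \<in> pts P" "p \<in> pts P"
    using less PO_P by (auto simp: PO_system_def)
  have "\<exists>z\<noteq>w. z \<in> Z p \<and> z \<in> U" if U: "w \<in> U" "openin W U" for U
  proof -
    obtain q B where B: "q \<in> pts Q" "\<alpha> q = r" "B \<in> Trim W Q Y q" "w \<in> B" "B \<subseteq> U"
      using Y_trim_nbhd_of_Z_member[OF rp(1) w U(2,1)] .
    obtain s where s: "s \<in> pts Q" "(q, s) \<in> lt Q" "\<alpha> s = p"
      using lift_less B(1,2) less by blast
    have "s \<in> type_of Q Y B"
      using Trim_D(3)[OF B(3)] s by (auto simp: up_set_def)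
    then obtain y where y: "y \<in> B" "y \<in> Y s"
      by (auto simp: type_of_def)
    show ?thesis
    proof (cases "y = w")
      case False
      then show ?thesis
        using y Y_subset[OF s(1)] s(3) B(5) by blast
    next
      case True
      \<comment> \<open>Then \<open>w\<close> lies in both \<open>Z r\<close> and \<open>Z p\<close>, so \<open>p = r < p\<close>; lifting \<open>p < p\<close> at \<open>s\<close> makes \<open>w\<close>
        a limit of points of another part of \<open>Y\<close> with image \<open>p\<close>.\<close>
      then have "w \<in> Z p"
        using y Y_subset[OF s(1)] s(3) by blast
      then have "p = r"
        using Z_disjoint rp w by blast
      then obtain t where t: "t \<in> pts Q" "(s, t) \<in> lt Q" "\<alpha> t = p"
        using lift_less[OF s(1)] s(3) less by blast
      obtain z where "z \<in> U" "z \<in> Y t" "z \<noteq> w"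
        using less_imp_limit_point[OF part_Y t(2)] y(2) True U by blast
      then show ?thesis
        using Y_subset[OF t(1)] t(3) by blast
    qed
  qed
  moreover have "w \<in> topspace W"
    using w by (simp add: consolidate_def)
  ultimately show ?thesis
    by (simp add: derived_set_of_def)
qed

lemma part_Z: "PO_partition W P Z"
proof -
  have "Z p \<noteq> {}" if p: "p \<in> pts P" for p
  proof -
    have "p \<in> \<alpha> ` pts Q"
      using p by (simp add: surj)
    then obtain q where "q \<in> pts Q" "\<alpha> q = p"
      by auto
    then show ?thesis
      using Y_subset[of q] part_Y by (auto simp: PO_partition_def)
  qed
  moreover have "Z p \<subseteq> topspace W" for p
    by (auto simp: consolidate_def)
  moreover have "disjoint_family_on Z (pts P)"
    using Z_disjoint unfolding disjoint_family_on_def by blast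
  moreover have "(W derived_set_of Z p) \<inter> (\<Union>r\<in>pts P. Z r) = (\<Union>q\<in>{q \<in> pts P. (q, p) \<in> lt P}. Z q)"
    if "p \<in> pts P" for p
    using Z_limit_imp_less[OF that] less_imp_Z_limit by blast
  ultimately show ?thesis
    using PO_P by (simp add: PO_partition_def)
qed

lemma T1_Z: "cond_T1 W P Z"
  unfolding cond_T1_def neighbourhood_base_at_def
proof (intro ballI allI impI)
  fix w U
  assume "w \<in> topspace W" and U: "openin W U \<and> w \<in> U"
  then obtain q A where A: "q \<in> pts Q" "A \<in> Trim W Q Y q" "w \<in> A" "A \<subseteq> U"
    using T1_trim_nbhd[OF T1_Y] by blast
  then show "\<exists>B V. openin W B \<and> (\<exists>p\<in>pts P. V \<in> Trim W P Z p) \<and> w \<in> B \<and> B \<subseteq> V \<and> V \<subseteq> U"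
    using Trim_Y_imp_Trim_Z[OF A(1,2)] \<alpha>_in Trim_D(2) by (metis order_refl)
qed

lemma T2_Z: "cond_T2 W P Z"
  unfolding cond_T2_def
proof (intro ballI impI)
  fix p w
  assume w: "w \<in> topspace W" and base: "neighbourhood_base_at w (\<lambda>A. A \<in> Trim W P Z p) W"
  have "\<exists>A\<in>Co W. w \<in> A \<and> A \<subseteq> U \<and> \<alpha> ` type_of Q Y A = up_set P p"
    if "openin W U" "w \<in> U" for U
  proof -
    have "\<exists>B A. openin W B \<and> A \<in> Trim W P Z p \<and> w \<in> B \<and> B \<subseteq> A \<and> A \<subseteq> U"
      using base that by (simp add: neighbourhood_base_at_def)
    then obtain A where "A \<in> Trim W P Z p" "w \<in> A" "A \<subseteq> U"
      by blast
    then show ?thesis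
      using Trim_D[of A W P Z p] type_of_Z[of A] by metis
  qed
  then show "w \<in> Z p"
    using w by (simp add: consolidate_def)
qed

lemma T3_Z: "cond_T3 W P Z"
  unfolding cond_T3_def
proof (intro ballI)
  fix p w
  assume p: "p \<in> pts P" and w: "w \<in> Z p"
  have "w \<in> topspace W"
    using w by (simp add: consolidate_def)
  then obtain q A where "q \<in> pts Q" "\<alpha> q = p" "A \<in> Trim W Q Y q" "w \<in> A"
    using Y_trim_nbhd_of_Z_member[OF p w openin_topspace] by metis
  then show "\<exists>A\<in>Trim W P Z p. w \<in> A"
    using Trim_Y_imp_Trim_Z by blast
qed

theorem trim_consolidate: "trim_partition W P Z"
  using part_Z T1_Z T2_Z T3_Z by (simp add: trim_partition_def)

theorem consolidate_regularly_via: "regularly_consolidates_via W P Z Q Y \<alpha>"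
proof -
  have "countable (pts Q)" "countable (pts P)"
    using countable_index_of_trim_partition[OF countable_Co] trim_Y trim_consolidate by blast+
  moreover have "p \<in> \<alpha> ` type_of Q Y A" if "p \<in> hat W P Z" "A \<in> Trim W P Z p" for p A
    using that Trim_D[OF that(2)] type_of_Z[of A] up_set_refl[of p P] by (auto simp: hat_def)
  ultimately show ?thesis
    using part_Z T1_Z part_Y T1_Y \<alpha>_in Y_subset by (auto simp: regularly_consolidates_via_def)
qed

end

section \<open>Relabellings correspond to equivalences\<close>

text \<open>
  From relabelling to equivalence, \<open>Y q\<close> lies in the parts with index \<open>\<alpha>2 q\<close> and
  \<open>\<beta> (\<alpha>1 q)\<close>, so these coincide.  In the other direction, an equivalence carries the
  description of the first partition by its index map to that of the second.
\<close>

lemma relabelling_iff_equivalent: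
  assumes W: "Hausdorff_space W" and Y: "trim_partition W Q Y"
    and Z1: "trim_partition W P1 Z1" and via1: "regularly_consolidates_via W P1 Z1 Q Y \<alpha>1"
    and Z2: "trim_partition W P2 Z2" and via2: "regularly_consolidates_via W P2 Z2 Q Y \<alpha>2"
  shows "((P1, Z1), (P2, Z2)) \<in> trim_relabelling W \<longleftrightarrow> ((P1, \<alpha>1), (P2, \<alpha>2)) \<in> Q_pair_equiv Q"
proof -
  have pairs: "Q_pair Q P1 \<alpha>1" "Q_pair Q P2 \<alpha>2"
    using consolidation_Q_pair[OF W Y] Z1 via1 Z2 via2 by blast+
  have "(\<forall>p\<in>pts P1. Z2 (\<beta> p) = Z1 p) \<longleftrightarrow> (\<forall>q\<in>pts Q. \<alpha>2 q = \<beta> (\<alpha>1 q))"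
    if \<beta>: "PO_iso P1 P2 \<beta>" for \<beta>
  proof
    have \<beta>_in: "\<beta> p \<in> pts P2" if "p \<in> pts P1" for p
      using \<beta> that bij_betwE unfolding PO_iso_def by metis
    show "\<forall>q\<in>pts Q. \<alpha>2 q = \<beta> (\<alpha>1 q)" if Z: "\<forall>p\<in>pts P1. Z2 (\<beta> p) = Z1 p"
    proof
      fix q
      assume q: "q \<in> pts Q"
      then have "Y q \<noteq> {}"
        using Y by (simp add: trim_partition_def PO_partition_def)
      then obtain y where "y \<in> Y q"
        by blast
      moreover have "\<alpha>1 q \<in> pts P1" "\<alpha>2 q \<in> pts P2"
        using pairs q by (auto simp: Q_pair_def)
      moreover have "Y q \<subseteq> Z1 (\<alpha>1 q)" "Y q \<subseteq> Z2 (\<alpha>2 q)"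
        using via1 via2 q by (auto simp: regularly_consolidates_via_def)
      ultimately show "\<alpha>2 q = \<beta> (\<alpha>1 q)"
        using member_index_unique[of W P2 Z2] Z2 Z \<beta>_in unfolding trim_partition_def by blast
    qed
    show "\<forall>p\<in>pts P1. Z2 (\<beta> p) = Z1 p" if \<alpha>: "\<forall>q\<in>pts Q. \<alpha>2 q = \<beta> (\<alpha>1 q)"
    proof
      fix p
      assume p: "p \<in> pts P1"
      have inj: "inj_on \<beta> (pts P1)"
        using \<beta> by (simp add: PO_iso_def bij_betw_def)
      have "\<alpha>2 ` type_of Q Y A = up_set P2 (\<beta> p) \<longleftrightarrow> \<alpha>1 ` type_of Q Y A = up_set P1 p" for A
      proof -
        have "\<alpha>2 ` type_of Q Y A = \<beta> ` \<alpha>1 ` type_of Q Y A"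
          using \<alpha> by (force simp: type_of_def)
        moreover have "\<alpha>1 ` type_of Q Y A \<subseteq> pts P1" "up_set P1 p \<subseteq> pts P1"
          using pairs(1) by (auto simp: Q_pair_def type_of_def up_set_def)
        ultimately show ?thesis
          using inj_on_image_eq_iff[OF inj] PO_iso_up_set[OF \<beta> p] by simp
      qed
      then have "consolidate W Q Y P2 \<alpha>2 (\<beta> p) = consolidate W Q Y P1 \<alpha>1 p"
        by (simp add: consolidate_def)
      then show "Z2 (\<beta> p) = Z1 p"
        using consolidation_determined_by_index_map[OF Z1 via1 p]
          consolidation_determined_by_index_map[OF Z2 via2 \<beta>_in[OF p]] by simp
    qed
  qed
  then show ?thesis
    using Z1 Z2 pairs unfolding trim_relabelling_def Q_pair_equiv_def by auto
qed

theorem theorem3p14: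
  fixes W :: "'w topology" and Q :: "'q po_sys" and Y :: "'q \<Rightarrow> 'w set"
  assumes "omega_Stone_space W" and "primitive_space W"
    and "PO_system Q" and "trim_partition W Q Y"
  shows "\<exists>\<Phi> :: ('p po_sys \<times> ('p \<Rightarrow> 'w set)) set \<Rightarrow> ('p po_sys \<times> ('q \<Rightarrow> 'p)) set.
    bij_betw \<Phi> (consolidation_classes W Q Y) (Q_pair_classes Q) \<and>
    (\<forall>P Z \<alpha>. trim_partition W P Z \<and> regularly_consolidates_via W P Z Q Y \<alpha> \<longrightarrow>
       \<Phi> (trim_relabelling W `` {(P, Z)}) = Q_pair_equiv Q `` {(P, \<alpha>)})"
proof -
  have W: "Hausdorff_space W" "countable (Co W)"
    using assms(1) by (auto simp: omega_Stone_space_def Stone_space_def)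
  define S :: "('p po_sys \<times> ('p \<Rightarrow> 'w set)) set"
    where "S = {(P, Z). trim_partition W P Z \<and> regularly_consolidates W P Z Q Y}"
  define B :: "('p po_sys \<times> ('q \<Rightarrow> 'p)) set"
    where "B = {(P, \<alpha>). Q_pair Q P \<alpha>}"
  define rel :: "'p po_sys \<times> ('p \<Rightarrow> 'w set) \<Rightarrow> 'p po_sys \<times> ('q \<Rightarrow> 'p) \<Rightarrow> bool"
    where "rel = (\<lambda>(P, Z) (P', \<alpha>). P' = P \<and> trim_partition W P Z \<and>
      regularly_consolidates_via W P Z Q Y \<alpha>)"
  have "\<exists>\<Phi>. bij_betw \<Phi> (S // trim_relabelling W) (B // Q_pair_equiv Q) \<and>
      (\<forall>x y. rel x y \<longrightarrow> \<Phi> (trim_relabelling W `` {x}) = Q_pair_equiv Q `` {y})"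
  proof (rule bij_betw_quotients_if_rel_respects)
    show "equiv {(P, X). trim_partition W P X} (trim_relabelling W)"
      by (rule equiv_trim_relabelling)
    show "equiv B (Q_pair_equiv Q)"
      unfolding B_def by (rule equiv_Q_pair_equiv)
    show "S \<subseteq> {(P, X). trim_partition W P X}"
      by (auto simp: S_def)
    show "x \<in> S \<and> y \<in> B" if "rel x y" for x y
      using that consolidation_Q_pair[OF W(1) assms(4)]
      by (auto simp: rel_def S_def B_def regularly_consolidates_def)
    show "\<exists>y. rel x y" if "x \<in> S" for x
      using that by (auto simp: rel_def S_def regularly_consolidates_def)
    show "\<exists>x. rel x y" if "y \<in> B" for y
    proof -
      obtain P \<alpha> where y: "y = (P, \<alpha>)" "Q_pair Q P \<alpha>"
        using \<open>y \<in> B\<close> by (auto simp: B_def)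
      then interpret pair_over_trim_partition W Q Y P \<alpha>
        using W assms(4) by unfold_locales
      have "rel (P, consolidate W Q Y P \<alpha>) y"
        using trim_consolidate consolidate_regularly_via y(1) by (simp add: rel_def)
      then show ?thesis ..
    qed
    show "(x, x') \<in> trim_relabelling W \<longleftrightarrow> (y, y') \<in> Q_pair_equiv Q" if "rel x y" "rel x' y'"
      for x y x' y'
      using that
      by (clarsimp simp: rel_def) (intro relabelling_iff_equivalent[OF W(1) assms(4)])
  qed
  then show ?thesis
    by (simp add: consolidation_classes_def Q_pair_classes_def S_def B_def rel_def)
qed

end
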